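(* Let $d_0$ be the distance from $x_0$ to $S_*$. Let $(x_k,y_k,t_k)_{k\in\mathbb{N}}$ be the sequence generated by I-FISTA (with associated $v_k,\varepsilon_k$). Then, for every $k\in\mathbb{N}$, $$r_k\in\partial_{\varepsilon_k}g(x_{k})+\nabla f(x_k)\subset\partial_{\varepsilon_k}F(x_{k}),$$ where $r_k:=v_k+\frac{L}{\tau}(y_{k}-x_k)+\nabla f(x_k)-\nabla f(y_k)$. Additionally, if $\tau<1$ and $\alpha\in(0,L(1-\tau)/\tau]$, then there exists $\ell_k\leq k$ such that $$\|r_{\ell_k}\|=\mathcal{O}\Big(d_0\sqrt{L^3/k^3}\Big),\qquad \varepsilon_{\ell_k}=\mathcal{O}\big(d_0^2L^2/k^3\big).$$
   Context: $\mathbb{N}=\{1,2,\dots\}$. $\mathbb{E}$ is a finite-dimensional real vector space with inner product $\langle\cdot,\cdot\rangle$ and induced norm $\|\cdot\|$. $f\colon\mathbb{E}\to\mathbb{R}$ is a differentiable convex function whose gradient is $L$-Lipschitz continuous, $L>0$; $g\colon\mathbb{E}\to\mathbb{R}\cup\{+\infty\}$ is a lower semicontinuous convex function, not necessarily differentiable; $F:=f+g$. The optimal value $F^*$ of $\min_{x\in\mathbb{E}}F(x)$ is assumed to be a real number, and the set $S_*$ of minimizers of $F$ is assumed nonempty. For $\varepsilon\ge 0$ and a convex function $h\colon\mathbb{E}\to\mathbb{R}\cup\{+\infty\}$, $\partial_\varepsilon h(x):=\{u\in\mathbb{E}\mid h(y)\ge h(x)+\langle u,y-x\rangle-\varepsilon\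 \ \forall y\in\mathbb{E}\}$. I-FISTA: let $x_0\in\mathbb{E}$, $\tau\in(0,1]$ and $\alpha\in[0,L(1-\tau)/\tau]$ be given. Set $y_1:=x_0$, $t_1:=1$, and for $k=1,2,\dots$ iterate: find a triple $(x_k,v_k,\varepsilon_k)\in\mathbb{E}\times\mathbb{E}\times[0,+\infty)$ such that $$v_k\in\partial_{\varepsilon_k}g(x_k)+\frac{L}{\tau}(x_k-y_k)+\nabla f(y_k),\qquad \|\tau v_k\|^2+2\tau\varepsilon_kL\le L[(1-\tau)L-\alpha\tau]\,\|x_k-y_k\|^2,$$ and set $$t_{k+1}:=\frac{1+\sqrt{1+4t_k^2}}{2},\qquad y_{k+1}:=x_k-\Big(\frac{t_k}{t_{k+1}}\Big)\frac{\tau}{L}v_k+\Big(\frac{t_k-1}{t_{k+1}}\Big)(x_k-x_{k-1}).$$ *)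

theory Defs
  imports "HOL-Analysis.Analysis"
begin

text \<open>Extended-valued functions \<open>\<E> \<rightarrow> \<real> \<union> {+\<infinity>}\<close> are functions into \<^typ>\<open>ereal\<close> that never take the
  value \<open>-\<infinity>\<close>; sequences indexed by the positive integers are functions on \<^typ>\<open>nat\<close> whose value at
  \<open>0\<close> is unconstrained (except for the starting point of \<open>x\<close>).\<close>

definition gradient :: "('a::euclidean_space \<Rightarrow> real) \<Rightarrow> 'a \<Rightarrow> 'a" where
  "gradient f x = (THE D. GDERIV f x :> D)"

text \<open>Here \<open>0 * \<infinity> = 0\<close> in \<^typ>\<open>ereal\<close>, so the end points of the segment cause no problem.\<close>

definition convex_ext :: "('a::real_vector \<Rightarrow> ereal) \<Rightarrow> bool" where
  "convex_ext h \<longleftrightarrow> (\<forall>x y. \<forall>s\<in>{0..1::real}.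
     h ((1 - s) *\<^sub>R x + s *\<^sub>R y) \<le> ereal (1 - s) * h x + ereal s * h y)"

definition lower_semicontinuous :: "('a::topological_space \<Rightarrow> ereal) \<Rightarrow> bool" where
  "lower_semicontinuous h \<longleftrightarrow> (\<forall>x. h x \<le> Liminf (at x) h)"

definition eps_subdifferential :: "real \<Rightarrow> ('a::real_inner \<Rightarrow> ereal) \<Rightarrow> 'a \<Rightarrow> 'a set" where
  "eps_subdifferential \<epsilon> h x = {u. \<forall>y. h y \<ge> h x + ereal (u \<bullet> (y - x)) - ereal \<epsilon>}"

definition objective :: "('a \<Rightarrow> real) \<Rightarrow> ('a \<Rightarrow> ereal) \<Rightarrow> 'a \<Rightarrow> ereal" where
  "objective f g x = ereal (f x) + g x"

definition minimizers :: "('a \<Rightarrow> ereal) \<Rightarrow> 'a set" where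
  "minimizers h = {x. \<forall>y. h x \<le> h y}"

definition composite_problem ::
  "real \<Rightarrow> ('a::euclidean_space \<Rightarrow> real) \<Rightarrow> ('a \<Rightarrow> ereal) \<Rightarrow> bool" where
  "composite_problem L f g \<longleftrightarrow>
     L > 0 \<and>
     convex_on UNIV f \<and> f differentiable_on UNIV \<and> L-lipschitz_on UNIV (gradient f) \<and>
     (\<forall>x. g x \<noteq> -\<infinity>) \<and> lower_semicontinuous g \<and> convex_ext g \<and>
     (\<exists>Fstar::real. (INF x. objective f g x) = ereal Fstar) \<and>
     minimizers (objective f g) \<noteq> {}"

text \<open>The sum of a set and a vector, \<open>S + c\<close>, is written as the image \<open>(+) c ` S\<close>.\<close>

definition I_FISTA ::
  "real \<Rightarrow> real \<Rightarrow> real \<Rightarrow> ('a::euclidean_space \<Rightarrow> real) \<Rightarrow> ('a \<Rightarrow> ereal) \<Rightarrow> 'a \<Rightarrow>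
   (nat \<Rightarrow> 'a) \<Rightarrow> (nat \<Rightarrow> 'a) \<Rightarrow> (nat \<Rightarrow> real) \<Rightarrow> (nat \<Rightarrow> 'a) \<Rightarrow> (nat \<Rightarrow> real) \<Rightarrow> bool" where
  "I_FISTA L \<tau> \<alpha> f g x0 x y t v \<epsilon> \<longleftrightarrow>
     \<tau> \<in> {0<..1} \<and> \<alpha> \<in> {0..L * (1 - \<tau>) / \<tau>} \<and>
     x 0 = x0 \<and> y 1 = x0 \<and> t 1 = 1 \<and>
     (\<forall>k\<ge>1.
        \<epsilon> k \<ge> 0 \<and>
        v k \<in> (+) ((L / \<tau>) *\<^sub>R (x k - y k) + gradient f (y k)) ` eps_subdifferential (\<epsilon> k) g (x k) \<and>
        (norm (\<tau> *\<^sub>R v k))\<^sup>2 + 2 * \<tau> * \<epsilon> k * L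
          \<le> L * ((1 - \<tau>) * L - \<alpha> * \<tau>) * (norm (x k - y k))\<^sup>2 \<and>
        t (k + 1) = (1 + sqrt (1 + 4 * (t k)\<^sup>2)) / 2 \<and>
        y (k + 1) = x k - ((t k / t (k + 1)) * (\<tau> / L)) *\<^sub>R v k
                        + ((t k - 1) / t (k + 1)) *\<^sub>R (x k - x (k - 1)))"

definition residual ::
  "real \<Rightarrow> real \<Rightarrow> ('a::euclidean_space \<Rightarrow> real) \<Rightarrow>
   (nat \<Rightarrow> 'a) \<Rightarrow> (nat \<Rightarrow> 'a) \<Rightarrow> (nat \<Rightarrow> 'a) \<Rightarrow> nat \<Rightarrow> 'a" where
  "residual L \<tau> f x y v k =
     v k + (L / \<tau>) *\<^sub>R (y k - x k) + gradient f (x k) - gradient f (y k)"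

end

theory Submission
  imports Defs
begin

text \<open>
  The inclusions are pure convexity: adding \<open>\<nabla>f(x\<^sub>k) - \<nabla>f(y\<^sub>k) + (L/\<tau>)(y\<^sub>k - x\<^sub>k)\<close> to \<open>v\<^sub>k\<close> cancels
  everything but an \<open>\<epsilon>\<^sub>k\<close>-subgradient of \<open>g\<close> and the gradient of \<open>f\<close> at \<open>x\<^sub>k\<close>, and the graph of \<open>f\<close>
  lies above its tangent plane (\<open>gradient_plus_subgradient\<close>).

  For the rate, the idea is to measure the objective gap at \<open>x\<^sub>k\<close> by distances to
  the corrected point \<open>x~\<^sub>k = x\<^sub>k - (\<tau>/L) v\<^sub>k\<close>.  In these terms an inexact step satisfies the
  inequality of an exact proximal gradient step with step size \<open>\<tau>/L\<close>; the errors \<open>v\<^sub>k\<close> and \<open>\<epsilon>\<^sub>k\<close> are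
  absorbed by the slack which \<open>\<tau>\<close> leaves in the descent lemma, and the acceptance test keeps
  \<open>(\<alpha>/2) \<parallel>x\<^sub>k - y\<^sub>k\<parallel>\<^sup>2\<close> of this slack unspent (\<open>inexact_step_inequality\<close>).  The extrapolation rule
  says \<open>t\<^sub>k\<^sub>+\<^sub>1 y\<^sub>k\<^sub>+\<^sub>1 = (t\<^sub>k\<^sub>+\<^sub>1 - 1) x\<^sub>k + t\<^sub>k x~\<^sub>k - (t\<^sub>k - 1) x\<^sub>k\<^sub>-\<^sub>1\<close>, so for a minimizer \<open>q\<close> the
  potential
  \<open>t\<^sub>k\<^sup>2 (F(x\<^sub>k) - F(q)) + L/(2\<tau>) \<parallel>t\<^sub>k x~\<^sub>k - (t\<^sub>k - 1) x\<^sub>k\<^sub>-\<^sub>1 - q\<parallel>\<^sup>2\<close>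
  decreases by at least \<open>(\<alpha>/2) t\<^sub>k\<^sup>2 \<parallel>x\<^sub>k - y\<^sub>k\<parallel>\<^sup>2\<close> in every step.  Hence the sum of these decrements
  is at most \<open>L/(2\<tau>) \<parallel>x\<^sub>0 - q\<parallel>\<^sup>2\<close> (\<open>potential_bound\<close>).

  Since \<open>t\<^sub>k\<close> grows linearly, the weights \<open>t\<^sub>j\<^sup>2\<close> for \<open>j \<le> k\<close> add up to at least \<open>k\<^sup>3 / 12\<close>, and so the
  shortest step among the first \<open>k\<close> has squared length \<open>O(L d\<^sub>0\<^sup>2 / k\<^sup>3)\<close> (\<open>short_prox_step\<close>).
  The residual is at most of order \<open>L\<close> times the step length and the error at most of order \<open>L\<close>
  times its square (\<open>residual_le_prox_step\<close>), which gives both rates at the same index.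
\<close>

section \<open>Convex functions with Lipschitz continuous gradient\<close>

text \<open>The derivative is a linear functional; applying its adjoint to \<open>1\<close> yields the vector that
  represents it, and testing two representing vectors on their difference shows uniqueness.\<close>

lemma GDERIV_gradient:
  fixes f :: "'a::euclidean_space \<Rightarrow> real"
  assumes "f differentiable_on UNIV"
  shows "GDERIV f x :> gradient f x"
proof -
  obtain f' where f': "(f has_derivative f') (at x)"
    using assms by (auto simp: differentiable_on_def differentiable_def)
  then have "f' h = h \<bullet> adjoint f' 1" for h
    using adjoint_works[of f' h 1] by (simp add: has_derivative_linear)
  with f' have ex: "GDERIV f x :> adjoint f' 1"
    unfolding gderiv_def by (metis (no_types, lifting) has_derivative_eq_rhs ext)
  have "D = D'" if "GDERIV f x :> D" "GDERIV f x :> D'" for D D'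
  proof -
    have "(\<lambda>h. h \<bullet> D) = (\<lambda>h. h \<bullet> D')"
      using that unfolding gderiv_def by (rule has_derivative_unique)
    then have "(D - D') \<bullet> D = (D - D') \<bullet> D'" by metis
    then show ?thesis by (metis eq_iff_diff_eq_0 inner_diff_right inner_eq_zero_iff)
  qed
  with ex have "\<exists>!D. GDERIV f x :> D" by blast
  then show ?thesis unfolding gradient_def by (rule theI')
qed

lemma DERIV_along_line:
  assumes "GDERIV f (y + s *\<^sub>R d) :> D"
  shows "((\<lambda>s. f (y + s *\<^sub>R d)) has_real_derivative (d \<bullet> D)) (at s)"
proof -
  have "((\<lambda>s. y + s *\<^sub>R d) has_derivative (\<lambda>h. h *\<^sub>R d)) (at s)"
    by (auto intro!: derivative_eq_intros)
  from has_derivative_compose[OF this assms[unfolded gderiv_def]]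
  show ?thesis by (simp add: has_field_derivative_def mult.commute[of "d \<bullet> D"] mult_commute_abs)
qed

text \<open>Restricting \<open>f\<close> to the line through \<open>y\<close> and \<open>z\<close> reduces this to the tangent inequality for
  convex functions of one real variable.\<close>

lemma convex_above_gradient_plane:
  fixes f :: "'a::euclidean_space \<Rightarrow> real"
  assumes f: "convex_on UNIV f" "f differentiable_on UNIV"
  shows "f y + gradient f y \<bullet> (z - y) \<le> f z"
proof -
  define \<phi> where "\<phi> s = f (y + s *\<^sub>R (z - y))" for s :: real
  have "convex_on UNIV \<phi>"
  proof (rule convex_onI)
    fix r a b :: real assume "0 < r" "r < 1"
    have "y + ((1 - r) * a + r * b) *\<^sub>R (z - y)
        = (1 - r) *\<^sub>R (y + a *\<^sub>R (z - y)) + r *\<^sub>R (y + b *\<^sub>R (z - y))"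
      by (simp add: algebra_simps)
    then show "\<phi> ((1 - r) *\<^sub>R a + r *\<^sub>R b) \<le> (1 - r) * \<phi> a + r * \<phi> b"
      using convex_onD[OF f(1), of r] \<open>0 < r\<close> \<open>r < 1\<close> by (simp add: \<phi>_def)
  qed auto
  moreover have "(\<phi> has_real_derivative (z - y) \<bullet> gradient f y) (at 0)"
    unfolding \<phi>_def
    using DERIV_along_line[of f y 0 "z - y"] GDERIV_gradient[OF f(2), of y] by simp
  ultimately have "\<phi> 1 - \<phi> 0 \<ge> ((z - y) \<bullet> gradient f y) * (1 - 0)"
    using convex_on_imp_above_tangent[of UNIV \<phi> 0 1] by simp
  then show ?thesis by (simp add: \<phi>_def inner_commute)
qed

text \<open>Along the segment from \<open>y\<close> to \<open>x\<close>, the difference of the two sides is monotone: the derivative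
  of \<open>f\<close> exceeds its initial value at parameter \<open>s\<close> by at most \<open>L s \<parallel>x - y\<parallel>\<^sup>2\<close>.\<close>

lemma descent_lemma:
  fixes f :: "'a::euclidean_space \<Rightarrow> real"
  assumes f: "f differentiable_on UNIV" "L-lipschitz_on UNIV (gradient f)"
  shows "f x \<le> f y + gradient f y \<bullet> (x - y) + L / 2 * (norm (x - y))\<^sup>2"
proof -
  define d where "d = x - y"
  define \<phi> where "\<phi> s = f (y + s *\<^sub>R d) - s * (d \<bullet> gradient f y) - L / 2 * s\<^sup>2 * (norm d)\<^sup>2"
    for s :: real
  have "\<phi> 1 \<le> \<phi> 0"
  proof (rule DERIV_nonpos_imp_nonincreasing[of 0 1 \<phi>])
    fix s :: real assume s: "0 \<le> s" "s \<le> 1"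
    let ?D = "d \<bullet> gradient f (y + s *\<^sub>R d) - d \<bullet> gradient f y - L * s * (norm d)\<^sup>2"
    have "(\<phi> has_real_derivative ?D) (at s)"
      unfolding \<phi>_def
      by (auto intro!: derivative_eq_intros DERIV_along_line GDERIV_gradient[OF f(1)])
    moreover have "?D \<le> 0"
    proof -
      have "d \<bullet> (gradient f (y + s *\<^sub>R d) - gradient f y)
          \<le> norm d * norm (gradient f (y + s *\<^sub>R d) - gradient f y)"
        by (rule norm_cauchy_schwarz)
      also have "\<dots> \<le> norm d * (L * norm (s *\<^sub>R d))"
        using lipschitz_on_normD[OF f(2), of "y + s *\<^sub>R d" y] by (simp add: mult_left_mono)
      finally show ?thesis using s by (simp add: inner_diff_right power2_eq_square mult_ac)
    qed
    ultimately show "\<exists>D. DERIV \<phi> s :> D \<and> D \<le> 0" by blast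
  qed simp
  then show ?thesis by (simp add: \<phi>_def d_def inner_commute)
qed

section \<open>Subgradients of the composite objective\<close>

text \<open>At a point where \<open>g\<close> is \<open>\<infinity>\<close>, the subgradient inequality would force \<open>g\<close> to be \<open>\<infinity>\<close> everywhere,
  and then the optimal value would not be real.  This is what allows the remaining arguments to
  compute with real numbers.\<close>

lemma subgradient_finite_at:
  fixes g :: "'a::euclidean_space \<Rightarrow> ereal"
  assumes "composite_problem L f g" "u \<in> eps_subdifferential \<epsilon> g x"
  shows "\<bar>g x\<bar> \<noteq> \<infinity>"
proof
  assume "\<bar>g x\<bar> = \<infinity>"
  with assms(1) have "g x = \<infinity>" by (auto simp: composite_problem_def)
  with assms(2) have "g z = \<infinity>" for z by (auto simp: eps_subdifferential_def split: if_splits)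
  then have "objective f g z = \<infinity>" for z by (simp add: objective_def)
  then show False using assms(1) by (auto simp: composite_problem_def)
qed

lemma gradient_plus_subgradient:
  fixes g :: "'a::euclidean_space \<Rightarrow> ereal"
  assumes "composite_problem L f g"
  shows "(+) (gradient f x) ` eps_subdifferential \<epsilon> g x
    \<subseteq> eps_subdifferential \<epsilon> (objective f g) x"
proof clarify
  fix u assume u: "u \<in> eps_subdifferential \<epsilon> g x"
  show "gradient f x + u \<in> eps_subdifferential \<epsilon> (objective f g) x"
    unfolding eps_subdifferential_def
  proof clarify
    fix z
    have "f x + gradient f x \<bullet> (z - x) \<le> f z"
      using assms by (intro convex_above_gradient_plane) (auto simp: composite_problem_def)
    moreover have "g x + ereal (u \<bullet> (z - x)) - ereal \<epsilon> \<le> g z"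
      using u by (auto simp: eps_subdifferential_def)
    moreover have "g z \<noteq> -\<infinity>" using assms by (auto simp: composite_problem_def)
    ultimately show "objective f g x + ereal ((gradient f x + u) \<bullet> (z - x)) - ereal \<epsilon>
        \<le> objective f g z"
      using subgradient_finite_at[OF assms u]
      by (cases "g x"; cases "g z") (auto simp: objective_def inner_add_left)
  qed
qed

section \<open>One inexact proximal gradient step\<close>

text \<open>Up to the last term, the right hand side is that for an exact proximal gradient step from \<open>y\<close> to
  \<open>xt\<close>.  Passing from \<open>x\<close> to \<open>xt\<close> completes the square and leaves the error
  \<open>\<tau>/(2L) \<parallel>v\<parallel>\<^sup>2 + \<epsilon> - (L/(2\<tau>) - L/2) \<parallel>x - y\<parallel>\<^sup>2\<close>, which is exactly what the acceptance test,
  divided by \<open>2\<tau>L\<close>, bounds by \<open>-(\<alpha>/2) \<parallel>x - y\<parallel>\<^sup>2\<close>.\<close>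

lemma inexact_step_inequality:
  fixes g :: "'a::euclidean_space \<Rightarrow> ereal"
  assumes prob: "composite_problem L f g" and \<tau>: "\<tau> > 0"
    and v: "v \<in> (+) ((L / \<tau>) *\<^sub>R (x - y) + gradient f y) ` eps_subdifferential \<epsilon> g x"
    and err: "(norm (\<tau> *\<^sub>R v))\<^sup>2 + 2 * \<tau> * \<epsilon> * L
      \<le> L * ((1 - \<tau>) * L - \<alpha> * \<tau>) * (norm (x - y))\<^sup>2"
    and a: "objective f g x = ereal a" and b: "objective f g z = ereal b"
    and xt: "xt = x - (\<tau> / L) *\<^sub>R v"
  shows "a - b \<le> L / \<tau> * ((y - xt) \<bullet> (xt - z)) + L / (2 * \<tau>) * (norm (y - xt))\<^sup>2
    - \<alpha> / 2 * (norm (x - y))\<^sup>2"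
proof -
  have L: "L > 0" using prob by (simp add: composite_problem_def)
  obtain u where u: "u \<in> eps_subdifferential \<epsilon> g x"
    and vu: "v = (L / \<tau>) *\<^sub>R (x - y) + gradient f y + u"
    using v by auto
  obtain gx gz where g: "g x = ereal gx" "g z = ereal gz" "a = f x + gx" "b = f z + gz"
    using a b by (cases "g x"; cases "g z") (auto simp: objective_def)
  have "gx + u \<bullet> (z - x) - \<epsilon> \<le> gz"
    using u g by (auto simp: eps_subdifferential_def dest: spec[of _ z])
  moreover have "f y + gradient f y \<bullet> (z - y) \<le> f z"
    using prob by (intro convex_above_gradient_plane) (auto simp: composite_problem_def)
  moreover have "f x \<le> f y + gradient f y \<bullet> (x - y) + L / 2 * (norm (x - y))\<^sup>2"
    using prob by (intro descent_lemma) (auto simp: composite_problem_def)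
  moreover have "u = v - (L / \<tau>) *\<^sub>R (x - y) - gradient f y" using vu by simp
  ultimately have 1: "a - b \<le> v \<bullet> (x - z) - L / \<tau> * ((x - y) \<bullet> (x - z))
      + L / 2 * (norm (x - y))\<^sup>2 + \<epsilon>"
    by (simp add: g inner_diff_left inner_diff_right algebra_simps)
  have "\<tau>\<^sup>2 * (v \<bullet> v) + 2 * \<tau> * \<epsilon> * L
      \<le> L * ((1 - \<tau>) * L - \<alpha> * \<tau>) * (norm (x - y))\<^sup>2"
    using err by (simp add: power_mult_distrib power2_norm_eq_inner)
  then have "(\<tau>\<^sup>2 * (v \<bullet> v) + 2 * \<tau> * \<epsilon> * L) / (2 * \<tau> * L)
      \<le> (L * ((1 - \<tau>) * L - \<alpha> * \<tau>) * (norm (x - y))\<^sup>2) / (2 * \<tau> * L)"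
    using \<tau> L by (intro divide_right_mono) auto
  moreover have "(\<tau>\<^sup>2 * (v \<bullet> v) + 2 * \<tau> * \<epsilon> * L) / (2 * \<tau> * L) = \<tau> / (2 * L) * (v \<bullet> v) + \<epsilon>"
    using \<tau> L by (simp add: field_simps power2_eq_square)
  moreover have "(L * ((1 - \<tau>) * L - \<alpha> * \<tau>) * (norm (x - y))\<^sup>2) / (2 * \<tau> * L)
      = (L / (2 * \<tau>) - L / 2 - \<alpha> / 2) * (norm (x - y))\<^sup>2"
    using \<tau> L by (simp add: field_simps)
  ultimately have 2: "\<tau> / (2 * L) * (v \<bullet> v) + \<epsilon>
      \<le> (L / (2 * \<tau>) - L / 2 - \<alpha> / 2) * (norm (x - y))\<^sup>2"
    by simp
  \<comment> \<open>completing the square in \<open>xt\<close>; with \<open>c = \<tau> / L\<close> it becomes a polynomial identity\<close>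
  have 3: "L / \<tau> * ((y - xt) \<bullet> (xt - z)) + L / (2 * \<tau>) * (norm (y - xt))\<^sup>2
      = v \<bullet> (x - z) - L / \<tau> * ((x - y) \<bullet> (x - z))
        + L / (2 * \<tau>) * (norm (x - y))\<^sup>2 - \<tau> / (2 * L) * (v \<bullet> v)"
  proof -
    define p where "p = x - y"
    define q where "q = x - z"
    define c where "c = \<tau> / L"
    have yx: "y - xt = c *\<^sub>R v - p" "xt - z = q - c *\<^sub>R v"
      by (simp_all add: xt p_def q_def c_def)
    have "c > 0" "L / \<tau> = 1 / c" "L / (2 * \<tau>) = 1 / (2 * c)" "\<tau> / (2 * L) = c / 2"
      using \<tau> L by (auto simp: c_def)
    with L show ?thesis
      unfolding yx p_def[symmetric] q_def[symmetric] power2_norm_eq_inner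
      by (simp add: inner_diff_left inner_diff_right inner_commute field_simps)
  qed
  show ?thesis using 1 2 3 by (simp add: algebra_simps)
qed

text \<open>The combination of Nesterov's acceleration: \<open>A\<close> and \<open>B\<close> stand for the objective gaps at the new
  and at the previous iterate \<open>p\<close>.  Weighting the inequality for \<open>p\<close> by \<open>t - 1\<close> and that for the
  minimizer \<open>q\<close> by \<open>1\<close>, then multiplying by \<open>t\<close>, turns the inner products into a difference of two
  squares.  The inequality for \<open>p\<close> is asked for only when \<open>t > 1\<close>, because in the first step \<open>p\<close> is
  the starting point, where the objective may be infinite.\<close>

lemma accelerated_combination:
  fixes y xt p q :: "'a::real_inner"
  assumes t: "t \<ge> 1"
    and A: "A \<le> L / \<tau> * ((y - xt) \<bullet> (xt - q)) + L / (2 * \<tau>) * (norm (y - xt))\<^sup>2 - n"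
    and B: "t > 1 \<Longrightarrow>
      A - B \<le> L / \<tau> * ((y - xt) \<bullet> (xt - p)) + L / (2 * \<tau>) * (norm (y - xt))\<^sup>2 - n"
  shows "t\<^sup>2 * A + L / (2 * \<tau>) * (norm (t *\<^sub>R xt - (t - 1) *\<^sub>R p - q))\<^sup>2 + t\<^sup>2 * n
    \<le> t * (t - 1) * B + L / (2 * \<tau>) * (norm (t *\<^sub>R y - (t - 1) *\<^sub>R p - q))\<^sup>2"
proof -
  define m where "m = L / (2 * \<tau>)"
  have m: "L / \<tau> = 2 * m" by (simp add: m_def)
  let ?R = "\<lambda>z. 2 * m * ((y - xt) \<bullet> (xt - z)) + m * (norm (y - xt))\<^sup>2 - n"
  have "(t - 1) * (A - B) \<le> (t - 1) * ?R p"
    using B t by (cases "t = 1") (auto simp: m m_def[symmetric] intro!: mult_left_mono)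
  then have "(t - 1) * (A - B) + A \<le> (t - 1) * ?R p + ?R q"
    using A by (simp add: m m_def[symmetric])
  then have "t * ((t - 1) * (A - B) + A) \<le> t * ((t - 1) * ?R p + ?R q)"
    using t by (intro mult_left_mono) auto
  moreover have "t * ((t - 1) * ?R p + ?R q)
    = m * (norm (t *\<^sub>R y - (t - 1) *\<^sub>R p - q))\<^sup>2 - m * (norm (t *\<^sub>R xt - (t - 1) *\<^sub>R p - q))\<^sup>2
      - t\<^sup>2 * n"
    unfolding power2_norm_eq_inner
    by (simp add: inner_diff_left inner_diff_right inner_commute algebra_simps power2_eq_square)
  ultimately show ?thesis
    unfolding m_def[symmetric] by (simp add: algebra_simps power2_eq_square)
qed

section \<open>The FISTA potential\<close>

text \<open>The recursion for \<open>t\<close> picks the positive root of \<open>T\<^sup>2 - T = t\<^sup>2\<close>, so that the weight on the old gap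
  in \<open>accelerated_combination\<close> equals the weight which that gap carries in the previous potential.
  The root is at least \<open>t + 1/2\<close>, whence the linear growth.\<close>

lemma I_FISTA_stepsizes:
  assumes "I_FISTA L \<tau> \<alpha> f g x0 x y t v \<epsilon>" "k \<ge> 1"
  shows "t (Suc k) * (t (Suc k) - 1) = (t k)\<^sup>2" and "t k \<ge> (real k + 1) / 2"
proof -
  have t1: "t 1 = 1" using assms(1) by (simp add: I_FISTA_def)
  have t: "t (Suc k) = (1 + sqrt (1 + 4 * (t k)\<^sup>2)) / 2" if "k \<ge> 1" for k
    using assms(1) that by (auto simp: I_FISTA_def)
  have "(sqrt (1 + 4 * (t k)\<^sup>2))\<^sup>2 = 1 + 4 * (t k)\<^sup>2"
    by (simp add: add_nonneg_nonneg)
  then show "t (Suc k) * (t (Suc k) - 1) = (t k)\<^sup>2"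
    by (simp add: t[OF assms(2)] field_simps power2_eq_square)
  show "t k \<ge> (real k + 1) / 2"
    using assms(2)
  proof (induction k rule: dec_induct)
    case (step k)
    have "2 * t k \<le> sqrt (1 + 4 * (t k)\<^sup>2)"
      by (rule real_le_rsqrt) (simp add: power_mult_distrib)
    with step t[of k] show ?case by simp
  qed (use t1 in simp)
qed

lemma sum_squares_ge_cube: "(\<Sum>j=1..k. (real j + 1)\<^sup>2) \<ge> real k ^ 3 / 3"
proof (induction k)
  case (Suc k)
  have "real (Suc k) ^ 3 / 3 \<le> real k ^ 3 / 3 + (real (Suc k) + 1)\<^sup>2"
    by (simp add: power2_eq_square power3_eq_cube algebra_simps)
  with Suc show ?case by simp
qed simp

lemma I_FISTA_objective_finite:
  fixes g :: "'a::euclidean_space \<Rightarrow> ereal"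
  assumes prob: "composite_problem L f g" and alg: "I_FISTA L \<tau> \<alpha> f g x0 x y t v \<epsilon>"
    and k: "k \<ge> 1"
  obtains a where "objective f g (x k) = ereal a"
proof -
  obtain u where "u \<in> eps_subdifferential (\<epsilon> k) g (x k)"
    using alg k unfolding I_FISTA_def by blast
  from subgradient_finite_at[OF prob this] that show ?thesis
    by (cases "g (x k)") (auto simp: objective_def)
qed

lemma minimizer_value:
  fixes g :: "'a::euclidean_space \<Rightarrow> ereal"
  assumes "composite_problem L f g" "q \<in> minimizers (objective f g)"
  obtains b where "objective f g q = ereal b"
proof -
  have "(INF x. objective f g x) = objective f g q"
    using assms(2) by (intro antisym INF_lower INF_greatest) (auto simp: minimizers_def)
  with assms(1) that show ?thesis by (auto simp: composite_problem_def)
qed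

text \<open>The potential telescopes: by the extrapolation rule the vector
  \<open>t\<^sub>k\<^sub>+\<^sub>1 y\<^sub>k\<^sub>+\<^sub>1 - (t\<^sub>k\<^sub>+\<^sub>1 - 1) x\<^sub>k\<close> in the bound for step \<open>k + 1\<close> is the vector
  \<open>t\<^sub>k x~\<^sub>k - (t\<^sub>k - 1) x\<^sub>k\<^sub>-\<^sub>1\<close> produced by step \<open>k\<close>.  Since the gap to the minimal value is nonnegative,
  the accumulated decrements are at most the initial potential, which is the right hand side.\<close>

lemma potential_bound:
  fixes g :: "'a::euclidean_space \<Rightarrow> ereal"
  assumes prob: "composite_problem L f g" and alg: "I_FISTA L \<tau> \<alpha> f g x0 x y t v \<epsilon>"
    and q: "q \<in> minimizers (objective f g)" and k: "k \<ge> 1"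
  shows "\<alpha> / 2 * (\<Sum>j=1..k. (t j)\<^sup>2 * (norm (x j - y j))\<^sup>2) \<le> L / (2 * \<tau>) * (norm (x0 - q))\<^sup>2"
proof -
  have L: "L > 0" using prob by (simp add: composite_problem_def)
  have \<tau>: "\<tau> > 0" and start: "x 0 = x0" "y 1 = x0" "t 1 = 1" using alg by (auto simp: I_FISTA_def)
  have step: "v k \<in> (+) ((L / \<tau>) *\<^sub>R (x k - y k) + gradient f (y k)) ` eps_subdifferential (\<epsilon> k) g (x k)"
    "(norm (\<tau> *\<^sub>R v k))\<^sup>2 + 2 * \<tau> * \<epsilon> k * L
      \<le> L * ((1 - \<tau>) * L - \<alpha> * \<tau>) * (norm (x k - y k))\<^sup>2"
    "y (Suc k) = x k - ((t k / t (k + 1)) * (\<tau> / L)) *\<^sub>R v k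
      + ((t k - 1) / t (k + 1)) *\<^sub>R (x k - x (k - 1))" if "k \<ge> 1" for k
    using alg that by (auto simp: I_FISTA_def)
  have t_ge: "t k \<ge> 1" if "k \<ge> 1" for k
    using I_FISTA_stepsizes(2)[OF alg that] that by simp
  obtain b where b: "objective f g q = ereal b" using minimizer_value[OF prob q] .
  \<comment> \<open>\<open>\<delta> 0\<close> may be the gap of an infinite value, hence meaningless; it enters only with the factor \<open>t 1 - 1 = 0\<close>\<close>
  define \<delta> where "\<delta> k = real_of_ereal (objective f g (x k)) - b" for k
  have val: "objective f g (x k) = ereal (b + \<delta> k)" and \<delta>_nonneg: "\<delta> k \<ge> 0" if j: "k \<ge> 1" for k
  proof -
    obtain a where a: "objective f g (x k) = ereal a"
      using I_FISTA_objective_finite[OF prob alg j] .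
    moreover have "objective f g q \<le> objective f g (x k)" using q by (auto simp: minimizers_def)
    ultimately show "objective f g (x k) = ereal (b + \<delta> k)" "\<delta> k \<ge> 0" by (auto simp: \<delta>_def b)
  qed
  define xt where "xt k = x k - (\<tau> / L) *\<^sub>R v k" for k
  define w where "w k = t k *\<^sub>R xt k - (t k - 1) *\<^sub>R x (k - 1)" for k
  define n where "n k = \<alpha> / 2 * (norm (x k - y k))\<^sup>2" for k
  have descent: "(t k)\<^sup>2 * \<delta> k + L / (2 * \<tau>) * (norm (w k - q))\<^sup>2 + (t k)\<^sup>2 * n k
    \<le> t k * (t k - 1) * \<delta> (k - 1)
      + L / (2 * \<tau>) * (norm (t k *\<^sub>R y k - (t k - 1) *\<^sub>R x (k - 1) - q))\<^sup>2"
    if k: "k \<ge> 1" for k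
    unfolding w_def
  proof (rule accelerated_combination[OF t_ge[OF k]])
    note ineq = inexact_step_inequality[OF prob \<tau> step(1,2)[OF k] val[OF k], where xt = "xt k"]
    show "\<delta> k \<le> L / \<tau> * ((y k - xt k) \<bullet> (xt k - q)) + L / (2 * \<tau>) * (norm (y k - xt k))\<^sup>2 - n k"
      using ineq[OF b] by (simp add: xt_def n_def)
    assume "t k > 1"
    with start k have "k - 1 \<ge> 1" by (cases "k = 1") auto
    then show "\<delta> k - \<delta> (k - 1) \<le> L / \<tau> * ((y k - xt k) \<bullet> (xt k - x (k - 1)))
        + L / (2 * \<tau>) * (norm (y k - xt k))\<^sup>2 - n k"
      using ineq[OF val[of "k - 1"]] by (simp add: xt_def n_def)
  qed
  have extrapolation: "t (Suc k) *\<^sub>R y (Suc k) - (t (Suc k) - 1) *\<^sub>R x k = w k" if "k \<ge> 1" for k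
  proof -
    have "t (Suc k) \<noteq> 0" using t_ge[of "Suc k"] by simp
    then show ?thesis
      by (simp add: step(3)[OF that] w_def xt_def algebra_simps diff_divide_distrib)
  qed
  have "(t k)\<^sup>2 * \<delta> k + L / (2 * \<tau>) * (norm (w k - q))\<^sup>2 + (\<Sum>j=1..k. (t j)\<^sup>2 * n j)
      \<le> L / (2 * \<tau>) * (norm (x0 - q))\<^sup>2"
    using k
  proof (induction k rule: dec_induct)
    case base
    show ?case using descent[of 1] start by simp
  next
    case (step k)
    have "(t (Suc k))\<^sup>2 * \<delta> (Suc k) + L / (2 * \<tau>) * (norm (w (Suc k) - q))\<^sup>2
        + (t (Suc k))\<^sup>2 * n (Suc k) \<le> (t k)\<^sup>2 * \<delta> k + L / (2 * \<tau>) * (norm (w k - q))\<^sup>2"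
      using descent[of "Suc k"] extrapolation[OF step(1)] I_FISTA_stepsizes(1)[OF alg step(1)] by simp
    with step.IH show ?case by simp
  qed
  moreover have "(t k)\<^sup>2 * \<delta> k + L / (2 * \<tau>) * (norm (w k - q))\<^sup>2 \<ge> 0"
    using \<delta>_nonneg[OF k] L \<tau> by simp
  moreover have "(\<Sum>j=1..k. (t j)\<^sup>2 * n j) = \<alpha> / 2 * (\<Sum>j=1..k. (t j)\<^sup>2 * (norm (x j - y j))\<^sup>2)"
    by (simp add: n_def sum_distrib_left mult_ac)
  ultimately show ?thesis by simp
qed

section \<open>Rate of the residuals\<close>

text \<open>The minimum of the step lengths is compared with their average weighted by \<open>t\<^sub>j\<^sup>2 \<ge> (j + 1)\<^sup>2 / 4\<close>;
  these weights sum to at least \<open>k\<^sup>3 / 12\<close>, which explains the constant.  The resulting bound holds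
  for every minimizer \<open>q\<close>, hence also for the infimum of their distances to the starting point.\<close>

lemma short_prox_step:
  fixes g :: "'a::euclidean_space \<Rightarrow> ereal"
  assumes prob: "composite_problem L f g" and alg: "I_FISTA L \<tau> \<alpha> f g x0 x y t v \<epsilon>"
    and \<alpha>: "\<alpha> > 0" and k: "k \<ge> 1"
  obtains l where "l \<in> {1..k}"
    "(norm (x l - y l))\<^sup>2 \<le>
      12 / (\<alpha> * \<tau>) * (L * (infdist x0 (minimizers (objective f g)))\<^sup>2 / real k ^ 3)"
proof -
  let ?S = "minimizers (objective f g)"
  have L: "L > 0" and S: "?S \<noteq> {}" using prob by (auto simp: composite_problem_def)
  have \<tau>: "\<tau> > 0" using alg by (auto simp: I_FISTA_def)
  define m where "m = Min ((\<lambda>j. norm (x j - y j)) ` {1..k})"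
  have "m \<in> (\<lambda>j. norm (x j - y j)) ` {1..k}" unfolding m_def using k by (intro Min_in) auto
  then obtain l where l: "l \<in> {1..k}" "m = norm (x l - y l)" by blast
  \<comment> \<open>\<open>c\<close> turns the estimate into \<open>m \<le> c * dist x0 q\<close>, which is linear in the distance\<close>
  define c where "c = sqrt (12 * L / (\<alpha> * \<tau> * real k ^ 3))"
  have c: "c > 0" using L \<alpha> \<tau> k by (simp add: c_def)
  have "m / c \<le> dist x0 q" if q: "q \<in> ?S" for q
  proof -
    have "real k ^ 3 / 3 * m\<^sup>2 \<le> (\<Sum>j=1..k. (real j + 1)\<^sup>2) * m\<^sup>2"
      by (intro mult_right_mono sum_squares_ge_cube) auto
    also have "\<dots> \<le> (\<Sum>j=1..k. 4 * ((t j)\<^sup>2 * (norm (x j - y j))\<^sup>2))"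
      unfolding sum_distrib_right
    proof (rule sum_mono)
      fix j assume j: "j \<in> {1..k}"
      have "real j + 1 \<le> 2 * t j" using I_FISTA_stepsizes(2)[OF alg, of j] j by simp
      moreover have "m \<le> norm (x j - y j)" unfolding m_def using j by (intro Min_le) auto
      moreover have "m \<ge> 0" by (simp add: l)
      ultimately have "(real j + 1)\<^sup>2 * m\<^sup>2 \<le> (2 * t j)\<^sup>2 * (norm (x j - y j))\<^sup>2"
        by (intro mult_mono power_mono) auto
      then show "(real j + 1)\<^sup>2 * m\<^sup>2 \<le> 4 * ((t j)\<^sup>2 * (norm (x j - y j))\<^sup>2)"
        by (simp add: power_mult_distrib)
    qed
    also have "\<dots> = 8 / \<alpha> * (\<alpha> / 2 * (\<Sum>j=1..k. (t j)\<^sup>2 * (norm (x j - y j))\<^sup>2))"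
      using \<alpha> by (simp add: sum_distrib_left)
    also have "\<dots> \<le> 8 / \<alpha> * (L / (2 * \<tau>) * (norm (x0 - q))\<^sup>2)"
      using \<alpha> by (intro mult_left_mono potential_bound[OF prob alg q k]) auto
    finally have "m\<^sup>2 \<le> 12 * L / (\<alpha> * \<tau> * real k ^ 3) * (norm (x0 - q))\<^sup>2"
      using k \<alpha> \<tau> by (simp add: field_simps)
    also have "\<dots> = (c * dist x0 q)\<^sup>2"
      using L \<alpha> \<tau> by (simp add: c_def power_mult_distrib dist_norm)
    finally have "m \<le> c * dist x0 q"
      by (rule power2_le_imp_le) (use c in auto)
    with c show ?thesis by (simp add: field_simps)
  qed
  then have "m / c \<le> infdist x0 ?S"
    unfolding infdist_notempty[OF S] using S by (intro cINF_greatest) auto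
  then have "m \<le> c * infdist x0 ?S" using c by (simp add: field_simps)
  then have "m\<^sup>2 \<le> (c * infdist x0 ?S)\<^sup>2" using l by (intro power_mono) auto
  also have "\<dots> = 12 / (\<alpha> * \<tau>) * (L * (infdist x0 ?S)\<^sup>2 / real k ^ 3)"
    using L \<alpha> \<tau> by (simp add: c_def power_mult_distrib)
  finally show ?thesis using that l by simp
qed

text \<open>The right hand side of the acceptance test is at most \<open>(L \<parallel>x\<^sub>k - y\<^sub>k\<parallel>)\<^sup>2\<close>, and the two
  nonnegative summands of its left hand side bound \<open>\<parallel>v\<^sub>k\<parallel>\<close> and \<open>\<epsilon>\<^sub>k\<close>.  The factor \<open>3\<close> counts \<open>v\<^sub>k\<close>, the proximal term
  and the gradient difference, each of which is at most \<open>(L/\<tau>) \<parallel>x\<^sub>k - y\<^sub>k\<parallel>\<close>.\<close>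

lemma residual_le_prox_step:
  fixes g :: "'a::euclidean_space \<Rightarrow> ereal"
  assumes prob: "composite_problem L f g" and alg: "I_FISTA L \<tau> \<alpha> f g x0 x y t v \<epsilon>"
    and k: "k \<ge> 1"
  shows "norm (residual L \<tau> f x y v k) \<le> 3 * L / \<tau> * norm (x k - y k)"
    and "\<epsilon> k \<le> L / (2 * \<tau>) * (norm (x k - y k))\<^sup>2"
proof -
  have L: "L > 0" using prob by (simp add: composite_problem_def)
  have \<tau>: "0 < \<tau>" "\<tau> \<le> 1" and \<alpha>: "\<alpha> \<ge> 0" and \<epsilon>: "\<epsilon> k \<ge> 0"
    and err: "(norm (\<tau> *\<^sub>R v k))\<^sup>2 + 2 * \<tau> * \<epsilon> k * L
      \<le> L * ((1 - \<tau>) * L - \<alpha> * \<tau>) * (norm (x k - y k))\<^sup>2"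
    using alg k by (auto simp: I_FISTA_def)
  have "(1 - \<tau>) * L - \<alpha> * \<tau> \<le> L"
    using L \<tau> \<alpha> by (simp add: algebra_simps add_nonneg_nonneg)
  then have "L * ((1 - \<tau>) * L - \<alpha> * \<tau>) * (norm (x k - y k))\<^sup>2 \<le> L * L * (norm (x k - y k))\<^sup>2"
    using L by (intro mult_right_mono mult_left_mono) auto
  also have "\<dots> = (L * norm (x k - y k))\<^sup>2"
    by (simp add: power_mult_distrib power2_eq_square)
  finally have bound: "(norm (\<tau> *\<^sub>R v k))\<^sup>2 + 2 * \<tau> * \<epsilon> k * L \<le> (L * norm (x k - y k))\<^sup>2"
    using err by linarith
  have "2 * \<tau> * \<epsilon> k * L \<le> (L * norm (x k - y k))\<^sup>2"
    using bound zero_le_power2[of "norm (\<tau> *\<^sub>R v k)"] by linarith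
  then show "\<epsilon> k \<le> L / (2 * \<tau>) * (norm (x k - y k))\<^sup>2"
    using L \<tau> by (simp add: field_simps power2_eq_square)
  have "2 * \<tau> * \<epsilon> k * L \<ge> 0" using L \<tau> \<epsilon> by simp
  with bound have "(norm (\<tau> *\<^sub>R v k))\<^sup>2 \<le> (L * norm (x k - y k))\<^sup>2" by linarith
  then have "norm (\<tau> *\<^sub>R v k) \<le> L * norm (x k - y k)"
    by (rule power2_le_imp_le) (use L in auto)
  then have v: "norm (v k) \<le> L / \<tau> * norm (x k - y k)" using \<tau> by (simp add: field_simps)
  have "norm (gradient f (x k) - gradient f (y k)) \<le> L * norm (x k - y k)"
    using prob by (intro lipschitz_on_normD[of L UNIV]) (auto simp: composite_problem_def)
  also have "\<dots> \<le> L / \<tau> * norm (x k - y k)"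
    using L \<tau> by (intro mult_right_mono) (auto simp: field_simps)
  finally have gr: "norm (gradient f (x k) - gradient f (y k)) \<le> L / \<tau> * norm (x k - y k)" .
  have "residual L \<tau> f x y v k
      = v k + (L / \<tau>) *\<^sub>R (y k - x k) + (gradient f (x k) - gradient f (y k))"
    by (simp add: residual_def)
  also have "norm \<dots> \<le> norm (v k) + norm ((L / \<tau>) *\<^sub>R (y k - x k))
      + norm (gradient f (x k) - gradient f (y k))"
    by (intro norm_triangle_le add_right_mono norm_triangle_ineq)
  also have "\<dots> \<le> 3 * (L / \<tau> * norm (x k - y k))"
    using v gr L \<tau> by (simp add: norm_minus_commute)
  finally show "norm (residual L \<tau> f x y v k) \<le> 3 * L / \<tau> * norm (x k - y k)" by simp
qed

text \<open>Both estimates hold at the index of the shortest step, and their constants depend on \<open>\<tau>\<close> and \<open>\<alpha>\<close>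
  only: the factors \<open>L\<close> and \<open>\<surd>L\<close>, from the residual and from the step length, combine to \<open>\<surd>(L\<^sup>3)\<close>.\<close>

lemma residual_rate:
  fixes g :: "'a::euclidean_space \<Rightarrow> ereal"
  assumes prob: "composite_problem L f g" and alg: "I_FISTA L \<tau> \<alpha> f g x0 x y t v \<epsilon>"
    and \<alpha>: "\<alpha> > 0" and k: "k \<ge> 1"
  defines "d \<equiv> infdist x0 (minimizers (objective f g))"
  shows "\<exists>l\<in>{1..k}.
    norm (residual L \<tau> f x y v l)
      \<le> 3 / \<tau> * sqrt (12 / (\<alpha> * \<tau>)) * (d * sqrt (L ^ 3 / real k ^ 3)) \<and>
    \<epsilon> l \<le> 6 / (\<alpha> * \<tau>\<^sup>2) * (d\<^sup>2 * L\<^sup>2 / real k ^ 3)"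
proof -
  have L: "L > 0" using prob by (simp add: composite_problem_def)
  have \<tau>: "\<tau> > 0" using alg by (auto simp: I_FISTA_def)
  have d: "d \<ge> 0" by (simp add: d_def infdist_nonneg)
  obtain l where l: "l \<in> {1..k}"
    and short: "(norm (x l - y l))\<^sup>2 \<le> 12 / (\<alpha> * \<tau>) * (L * d\<^sup>2 / real k ^ 3)"
    using short_prox_step[OF prob alg \<alpha> k] unfolding d_def .
  note le = residual_le_prox_step[OF prob alg, of l]
  have "norm (x l - y l) \<le> sqrt (12 / (\<alpha> * \<tau>) * (L * d\<^sup>2 / real k ^ 3))"
    using short by (rule real_le_rsqrt)
  also have "\<dots> = sqrt (12 / (\<alpha> * \<tau>)) * (d * sqrt (L / real k ^ 3))"
    using d by (simp add: real_sqrt_mult real_sqrt_divide)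
  finally have "3 * L / \<tau> * norm (x l - y l)
      \<le> 3 * L / \<tau> * (sqrt (12 / (\<alpha> * \<tau>)) * (d * sqrt (L / real k ^ 3)))"
    using L \<tau> by (intro mult_left_mono) auto
  also have "\<dots> = 3 / \<tau> * sqrt (12 / (\<alpha> * \<tau>)) * (d * (L * sqrt (L / real k ^ 3)))" by simp
  also have "L * sqrt (L / real k ^ 3) = sqrt (L ^ 3 / real k ^ 3)"
  proof -
    have "L ^ 3 / real k ^ 3 = L\<^sup>2 * (L / real k ^ 3)" by (simp add: power2_eq_square power3_eq_cube)
    then show ?thesis using L by (simp only: real_sqrt_mult) simp
  qed
  finally have r: "norm (residual L \<tau> f x y v l)
      \<le> 3 / \<tau> * sqrt (12 / (\<alpha> * \<tau>)) * (d * sqrt (L ^ 3 / real k ^ 3))"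
    using le(1) l by auto
  have "\<epsilon> l \<le> L / (2 * \<tau>) * (norm (x l - y l))\<^sup>2" using le(2) l by simp
  also have "\<dots> \<le> L / (2 * \<tau>) * (12 / (\<alpha> * \<tau>) * (L * d\<^sup>2 / real k ^ 3))"
    using short L \<tau> by (intro mult_left_mono) auto
  also have "\<dots> = 6 / (\<alpha> * \<tau>\<^sup>2) * (d\<^sup>2 * L\<^sup>2 / real k ^ 3)"
    using \<tau> \<alpha> k by (simp add: field_simps power2_eq_square)
  finally show ?thesis using r l by blast
qed

lemma residual_in_subdifferential:
  assumes "I_FISTA L \<tau> \<alpha> f g x0 x y t v \<epsilon>" "k \<ge> 1"
  shows "residual L \<tau> f x y v k \<in> (+) (gradient f (x k)) ` eps_subdifferential (\<epsilon> k) g (x k)"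
proof -
  obtain u where u: "u \<in> eps_subdifferential (\<epsilon> k) g (x k)"
    and v: "v k = (L / \<tau>) *\<^sub>R (x k - y k) + gradient f (y k) + u"
    using assms unfolding I_FISTA_def by blast
  have "residual L \<tau> f x y v k = gradient f (x k) + u"
    by (simp add: residual_def v algebra_simps)
  with u show ?thesis by blast
qed

theorem theorem4p4:
  fixes \<tau> \<alpha> :: real
  shows
    "(\<forall>L (f :: 'a::euclidean_space \<Rightarrow> real) g x0 x y t v \<epsilon>.
        composite_problem L f g \<longrightarrow> I_FISTA L \<tau> \<alpha> f g x0 x y t v \<epsilon> \<longrightarrow>
        (\<forall>k\<ge>1.
           residual L \<tau> f x y v k
             \<in> (+) (gradient f (x k)) ` eps_subdifferential (\<epsilon> k) g (x k) \<and>
           (+) (gradient f (x k)) ` eps_subdifferential (\<epsilon> k) g (x k)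
             \<subseteq> eps_subdifferential (\<epsilon> k) (objective f g) (x k)))
     \<and>
     (\<tau> < 1 \<and> \<alpha> > 0 \<longrightarrow>
      (\<exists>C D :: real. \<forall>L (f :: 'a \<Rightarrow> real) g x0 x y t v \<epsilon>.
        composite_problem L f g \<longrightarrow> I_FISTA L \<tau> \<alpha> f g x0 x y t v \<epsilon> \<longrightarrow>
        (\<forall>k\<ge>1. \<exists>l\<in>{1..k}.
           norm (residual L \<tau> f x y v l)
             \<le> C * (infdist x0 (minimizers (objective f g)) * sqrt (L ^ 3 / real k ^ 3)) \<and>
           \<epsilon> l \<le> D * ((infdist x0 (minimizers (objective f g)))\<^sup>2 * L\<^sup>2 / real k ^ 3))))"
proof (intro conjI allI impI)
  fix L :: real and f :: "'a \<Rightarrow> real" and g x0 x y t v \<epsilon> and k :: nat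
  assume "composite_problem L f g" "I_FISTA L \<tau> \<alpha> f g x0 x y t v \<epsilon>" "k \<ge> 1"
  then show "residual L \<tau> f x y v k
        \<in> (+) (gradient f (x k)) ` eps_subdifferential (\<epsilon> k) g (x k)"
    and "(+) (gradient f (x k)) ` eps_subdifferential (\<epsilon> k) g (x k)
        \<subseteq> eps_subdifferential (\<epsilon> k) (objective f g) (x k)"
    using residual_in_subdifferential gradient_plus_subgradient by blast+
next
  assume "\<tau> < 1 \<and> \<alpha> > 0"
  then show "\<exists>C D :: real. \<forall>L (f :: 'a \<Rightarrow> real) g x0 x y t v \<epsilon>.
        composite_problem L f g \<longrightarrow> I_FISTA L \<tau> \<alpha> f g x0 x y t v \<epsilon> \<longrightarrow>
        (\<forall>k\<ge>1. \<exists>l\<in>{1..k}.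
           norm (residual L \<tau> f x y v l)
             \<le> C * (infdist x0 (minimizers (objective f g)) * sqrt (L ^ 3 / real k ^ 3)) \<and>
           \<epsilon> l \<le> D * ((infdist x0 (minimizers (objective f g)))\<^sup>2 * L\<^sup>2 / real k ^ 3))"
    by (intro exI[of _ "3 / \<tau> * sqrt (12 / (\<alpha> * \<tau>))"] exI[of _ "6 / (\<alpha> * \<tau>\<^sup>2)"] allI impI
        residual_rate) auto
qed

end
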